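(* If $Y$ is a $2$-Engel group, then $Y$ is an intrinsic Schreier special object with respect to every natural imaginary splitting in the category $\mathsf{Gp}$ of groups.
   Context: A group $E$ is $2$-Engel if $[[x,y],y]=1$ for all $x,y\in E$, where $[x,y]=xyx^{-1}y^{-1}$. In $\mathsf{Gp}$ imaginary morphisms are taken with respect to the free group comonad, so an imaginary morphism $X\dashrightarrow Y$ between groups is just a function between the underlying sets (equivalently, a homomorphism from the free group on the set $X$ to $Y$), and composition of imaginary morphisms is composition of functions. A natural imaginary splitting in $\mathsf{Gp}$ is a family of functions $t_{X,Y}\colon X\times Y\to X+Y$ (with $X+Y$ the free product), for all groups $X,Y$, which is natural, i.e. $(f+g)\,t_{X,Y}=t_{X',Y'}\,(f\times g)$ for all homomorphisms $f\colon X\to X'$, $g\colon Y\to Y'$, and which satisfies $r_{X,Y}(t_{X,Y}(x,y))=(x,y)$ for all $x\in X$, $y\in Y$, where $r_{X,Y}\colon X+Y\to X\times Y$ is the canonical homomorphism. It induces on each group $X$ an imaginary addition, the function $\mu^X=\nabla_X t_{X,X}\colon X\times X\to X$, where $\nabla_X\colon X+X\to X$ is the codiagonal. A split epimorphism of groups $f\colon X\to Y$ with chosen section $s$ and kernel $k\colon K\to X$ is intrinsic Schreier with respect to $t$ if there is a function $q\colon X\to K$ with $\mu^X(kq(x),sf(x))=x$ for all $x\in X$ and $q(\mu^X(k(a),s(y)))=a$ for all $a\in K$, $y\in Y$. A group $Y$ is an intrinsic Schreier special object with respect to $t$ if the split epimorphism $\pi_2\colon Y\times Y\to Y$ (second projection)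 with section $\langle 1_Y,1_Y\rangle$ (diagonal) and kernel $\langle 1_Y,0\rangle\colon Y\to Y\times Y$, $y\mapsto (y,1)$, is intrinsic Schreier with respect to $t$. *)

theory Defs
  imports "HOL-Algebra.Coset" "HOL-Library.Infinite_Typeclass"
begin

section \<open>Free products of two groups\<close>

text \<open>The free product is the set of words over the disjoint union of the two carriers, modulo
  the congruence that multiplies adjacent letters of the same factor and erases units.\<close>

abbreviation fp_words :: "('a, 'm) monoid_scheme \<Rightarrow> ('b, 'n) monoid_scheme \<Rightarrow> ('a + 'b) list set" where
  "fp_words X Y \<equiv> lists (carrier X <+> carrier Y)"

inductive fp_eq :: "('a, 'm) monoid_scheme \<Rightarrow> ('b, 'n) monoid_scheme \<Rightarrow>
    ('a + 'b) list \<Rightarrow> ('a + 'b) list \<Rightarrow> bool" for X Y where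
  refl: "w \<in> fp_words X Y \<Longrightarrow> fp_eq X Y w w"
| sym: "fp_eq X Y u v \<Longrightarrow> fp_eq X Y v u"
| trans: "fp_eq X Y u v \<Longrightarrow> fp_eq X Y v w \<Longrightarrow> fp_eq X Y u w"
| mult_l: "\<lbrakk>u \<in> fp_words X Y; v \<in> fp_words X Y; a \<in> carrier X; b \<in> carrier X\<rbrakk> \<Longrightarrow>
    fp_eq X Y (u @ [Inl a, Inl b] @ v) (u @ [Inl (a \<otimes>\<^bsub>X\<^esub> b)] @ v)"
| mult_r: "\<lbrakk>u \<in> fp_words X Y; v \<in> fp_words X Y; a \<in> carrier Y; b \<in> carrier Y\<rbrakk> \<Longrightarrow>
    fp_eq X Y (u @ [Inr a, Inr b] @ v) (u @ [Inr (a \<otimes>\<^bsub>Y\<^esub> b)] @ v)"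
| one_l: "\<lbrakk>u \<in> fp_words X Y; v \<in> fp_words X Y\<rbrakk> \<Longrightarrow>
    fp_eq X Y (u @ [Inl \<one>\<^bsub>X\<^esub>] @ v) (u @ v)"
| one_r: "\<lbrakk>u \<in> fp_words X Y; v \<in> fp_words X Y\<rbrakk> \<Longrightarrow>
    fp_eq X Y (u @ [Inr \<one>\<^bsub>Y\<^esub>] @ v) (u @ v)"

definition fp_rel :: "('a, 'm) monoid_scheme \<Rightarrow> ('b, 'n) monoid_scheme \<Rightarrow>
    (('a + 'b) list \<times> ('a + 'b) list) set" where
  "fp_rel X Y = {(u, v). fp_eq X Y u v}"

definition fp_class :: "('a, 'm) monoid_scheme \<Rightarrow> ('b, 'n) monoid_scheme \<Rightarrow>
    ('a + 'b) list \<Rightarrow> ('a + 'b) list set" where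
  "fp_class X Y w = fp_rel X Y `` {w}"

definition free_product :: "('a, 'm) monoid_scheme \<Rightarrow> ('b, 'n) monoid_scheme \<Rightarrow>
    ('a + 'b) list set monoid" where
  "free_product X Y =
    \<lparr>carrier = fp_words X Y // fp_rel X Y,
     mult = (\<lambda>A B. \<Union>u\<in>A. \<Union>v\<in>B. fp_class X Y (u @ v)),
     one = fp_class X Y []\<rparr>"

definition fp_inl :: "('a, 'm) monoid_scheme \<Rightarrow> ('b, 'n) monoid_scheme \<Rightarrow> 'a \<Rightarrow> ('a + 'b) list set" where
  "fp_inl X Y a = fp_class X Y [Inl a]"

definition fp_inr :: "('a, 'm) monoid_scheme \<Rightarrow> ('b, 'n) monoid_scheme \<Rightarrow> 'b \<Rightarrow> ('a + 'b) list set" where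
  "fp_inr X Y b = fp_class X Y [Inr b]"

definition fp_eval :: "('c, 'k) monoid_scheme \<Rightarrow> ('a \<Rightarrow> 'c) \<Rightarrow> ('b \<Rightarrow> 'c) \<Rightarrow> ('a + 'b) list \<Rightarrow> 'c" where
  "fp_eval Z f g w = foldr (\<lambda>s z. case_sum f g s \<otimes>\<^bsub>Z\<^esub> z) w \<one>\<^bsub>Z\<^esub>"

text \<open>The homomorphism \<open>[f, g] : X + Y \<rightarrow> Z\<close>; the image below is a singleton when \<open>f\<close> and \<open>g\<close>
  are homomorphisms (see \<open>fp_copair_class\<close>).\<close>

definition fp_copair :: "('c, 'k) monoid_scheme \<Rightarrow> ('a \<Rightarrow> 'c) \<Rightarrow> ('b \<Rightarrow> 'c) \<Rightarrow> ('a + 'b) list set \<Rightarrow> 'c" where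
  "fp_copair Z f g A = the_elem (fp_eval Z f g ` A)"

definition fp_map :: "('c, 'k) monoid_scheme \<Rightarrow> ('d, 'l) monoid_scheme \<Rightarrow> ('a \<Rightarrow> 'c) \<Rightarrow> ('b \<Rightarrow> 'd) \<Rightarrow>
    ('a + 'b) list set \<Rightarrow> ('c + 'd) list set" where
  "fp_map X' Y' f g = fp_copair (free_product X' Y') (fp_inl X' Y' \<circ> f) (fp_inr X' Y' \<circ> g)"

definition fp_to_prod :: "('a, 'm) monoid_scheme \<Rightarrow> ('b, 'n) monoid_scheme \<Rightarrow> ('a + 'b) list set \<Rightarrow> 'a \<times> 'b" where
  "fp_to_prod X Y = fp_copair (X \<times>\<times> Y) (\<lambda>x. (x, \<one>\<^bsub>Y\<^esub>)) (\<lambda>y. (\<one>\<^bsub>X\<^esub>, y))"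

definition codiagonal :: "('a, 'm) monoid_scheme \<Rightarrow> ('a + 'a) list set \<Rightarrow> 'a" where
  "codiagonal X = fp_copair X (\<lambda>x. x) (\<lambda>x. x)"


section \<open>2-Engel groups\<close>

definition commutator :: "('a, 'm) monoid_scheme \<Rightarrow> 'a \<Rightarrow> 'a \<Rightarrow> 'a" where
  "commutator G x y = x \<otimes>\<^bsub>G\<^esub> y \<otimes>\<^bsub>G\<^esub> inv\<^bsub>G\<^esub> x \<otimes>\<^bsub>G\<^esub> inv\<^bsub>G\<^esub> y"

definition two_engel_group :: "('a, 'm) monoid_scheme \<Rightarrow> bool" where
  "two_engel_group G \<longleftrightarrow> group G \<and>
    (\<forall>x\<in>carrier G. \<forall>y\<in>carrier G. commutator G (commutator G x y) y = \<one>\<^bsub>G\<^esub>)"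


section \<open>Natural imaginary splittings of groups\<close>

text \<open>HOL has no type of all groups, so the objects of the category of groups are the groups
  whose carrier is a subset of an arbitrary infinite type \<open>'u\<close>, that is (up to isomorphism) all
  groups of cardinality at most \<open>|'u|\<close>. Being infinite makes this class closed, up to
  isomorphism, under binary products and free products. A natural family on all groups
  restricts to one on the groups in \<open>'u\<close>.\<close>

type_synonym 'u imaginary_family =
  "'u monoid \<Rightarrow> 'u monoid \<Rightarrow> 'u \<times> 'u \<Rightarrow> ('u + 'u) list set"

definition natural_imaginary_splitting :: "('u::infinite) imaginary_family \<Rightarrow> bool" where
  "natural_imaginary_splitting t \<longleftrightarrow>
    (\<forall>X Y. group X \<longrightarrow> group Y \<longrightarrow>
       t X Y \<in> carrier X \<times> carrier Y \<rightarrow> carrier (free_product X Y)) \<and>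
    (\<forall>X Y X' Y' f g. group X \<longrightarrow> group Y \<longrightarrow> group X' \<longrightarrow> group Y' \<longrightarrow>
       f \<in> hom X X' \<longrightarrow> g \<in> hom Y Y' \<longrightarrow>
       (\<forall>x\<in>carrier X. \<forall>y\<in>carrier Y. fp_map X' Y' f g (t X Y (x, y)) = t X' Y' (f x, g y))) \<and>
    (\<forall>X Y. group X \<longrightarrow> group Y \<longrightarrow>
       (\<forall>x\<in>carrier X. \<forall>y\<in>carrier Y. fp_to_prod X Y (t X Y (x, y)) = (x, y)))"

definition imaginary_addition :: "('u::infinite) imaginary_family \<Rightarrow> 'u monoid \<Rightarrow> 'u \<times> 'u \<Rightarrow> 'u" where
  "imaginary_addition t X = codiagonal X \<circ> t X X"


section \<open>Intrinsic Schreier split epimorphisms and special objects\<close>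

definition split_epi_with_kernel ::
  "'a monoid \<Rightarrow> 'b monoid \<Rightarrow> 'c monoid \<Rightarrow> ('a \<Rightarrow> 'b) \<Rightarrow> ('b \<Rightarrow> 'a) \<Rightarrow> ('c \<Rightarrow> 'a) \<Rightarrow> bool" where
  "split_epi_with_kernel X Y K f s k \<longleftrightarrow>
    group X \<and> group Y \<and> group K \<and> f \<in> hom X Y \<and> s \<in> hom Y X \<and>
    (\<forall>y\<in>carrier Y. f (s y) = y) \<and> k \<in> mon K X \<and> k ` carrier K = kernel X Y f"

definition intrinsic_schreier :: "('u::infinite) imaginary_family \<Rightarrow>
    'u monoid \<Rightarrow> 'u monoid \<Rightarrow> 'u monoid \<Rightarrow> ('u \<Rightarrow> 'u) \<Rightarrow> ('u \<Rightarrow> 'u) \<Rightarrow> ('u \<Rightarrow> 'u) \<Rightarrow> bool" where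
  "intrinsic_schreier t X Y K f s k \<longleftrightarrow>
    split_epi_with_kernel X Y K f s k \<and>
    (\<exists>q \<in> carrier X \<rightarrow> carrier K.
       (\<forall>x\<in>carrier X. imaginary_addition t X (k (q x), s (f x)) = x) \<and>
       (\<forall>a\<in>carrier K. \<forall>y\<in>carrier Y. q (imaginary_addition t X (k a, s y)) = a))"

text \<open>\<open>Y \<times>\<times> Y\<close> has the type \<open>('u \<times> 'u) monoid\<close>, so the product object in the category of groups
  in \<open>'u\<close> is a group \<open>P\<close> with an isomorphism \<open>h : P \<cong> Y \<times>\<times> Y\<close>; its projections are \<open>fst \<circ> h\<close> and
  \<open>snd \<circ> h\<close>. The condition is required of every such presentation of the product, and there is
  always one (see \<open>exists_direct_product\<close>).\<close>

definition intrinsic_schreier_special :: "('u::infinite) imaginary_family \<Rightarrow> 'u monoid \<Rightarrow> bool" where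
  "intrinsic_schreier_special t Y \<longleftrightarrow> group Y \<and>
    (\<forall>(P :: 'u monoid) h. group P \<longrightarrow> h \<in> iso P (Y \<times>\<times> Y) \<longrightarrow>
       intrinsic_schreier t P Y Y
         (snd \<circ> h)
         (\<lambda>y. inv_into (carrier P) h (y, y))
         (\<lambda>y. inv_into (carrier P) h (y, \<one>\<^bsub>Y\<^esub>)))"


section \<open>The constructions have the intended universal properties\<close>

lemma Inl_in_Plus_iff [simp]: "Inl a \<in> A <+> B \<longleftrightarrow> a \<in> A" by auto

lemma Inr_in_Plus_iff [simp]: "Inr b \<in> A <+> B \<longleftrightarrow> b \<in> B" by auto

lemma fp_eq_words: "fp_eq X Y u v \<Longrightarrow> group X \<Longrightarrow> group Y \<Longrightarrow> u \<in> fp_words X Y \<and> v \<in> fp_words X Y"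
  by (induction rule: fp_eq.induct) (auto intro: monoid.m_closed monoid.one_closed group.is_monoid)

lemma fp_eq_append:
  assumes "fp_eq X Y u v" "a \<in> fp_words X Y" "b \<in> fp_words X Y"
  shows "fp_eq X Y (a @ u @ b) (a @ v @ b)"
  using assms
proof (induction rule: fp_eq.induct)
  case (refl w)
  then show ?case by (auto intro!: fp_eq.refl)
next
  case (mult_l u v x y)
  then show ?case using fp_eq.mult_l[of "a @ u" X Y "v @ b" x y] by simp
next
  case (mult_r u v x y)
  then show ?case using fp_eq.mult_r[of "a @ u" X Y "v @ b" x y] by simp
next
  case (one_l u v)
  then show ?case using fp_eq.one_l[of "a @ u" X Y "v @ b"] by simp
next
  case (one_r u v)
  then show ?case using fp_eq.one_r[of "a @ u" X Y "v @ b"] by simp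
qed (blast intro: fp_eq.sym fp_eq.trans)+

context
  fixes X :: "('a, 'm) monoid_scheme" and Y :: "('b, 'n) monoid_scheme"
  assumes X: "group X" and Y: "group Y"
begin

interpretation X: group X by (rule X)
interpretation Y: group Y by (rule Y)

lemma equiv_fp_rel: "equiv (fp_words X Y) (fp_rel X Y)"
proof (rule equivI)
  show "fp_rel X Y \<subseteq> fp_words X Y \<times> fp_words X Y"
    unfolding fp_rel_def using fp_eq_words[OF _ X Y] by blast
  show "refl_on (fp_words X Y) (fp_rel X Y)"
    unfolding fp_rel_def refl_on_def using fp_eq.refl by blast
  show "sym (fp_rel X Y)"
    unfolding fp_rel_def by (rule symI) (use fp_eq.sym in blast)
  show "trans (fp_rel X Y)"
    unfolding fp_rel_def by (rule transI) (use fp_eq.trans in blast)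
qed

lemma fp_class_eq_iff:
  "u \<in> fp_words X Y \<Longrightarrow> v \<in> fp_words X Y \<Longrightarrow> fp_class X Y u = fp_class X Y v \<longleftrightarrow> fp_eq X Y u v"
  unfolding fp_class_def using eq_equiv_class_iff[OF equiv_fp_rel] by (auto simp: fp_rel_def)

lemma in_fp_class: "v \<in> fp_class X Y u \<longleftrightarrow> fp_eq X Y u v"
  by (simp add: fp_class_def fp_rel_def)

lemma fp_class_closed: "w \<in> fp_words X Y \<Longrightarrow> fp_class X Y w \<in> carrier (free_product X Y)"
  by (simp add: free_product_def fp_class_def quotientI)

lemma fp_carrierE:
  assumes "A \<in> carrier (free_product X Y)"
  obtains w where "w \<in> fp_words X Y" "A = fp_class X Y w"
  using assms by (auto simp: free_product_def fp_class_def elim!: quotientE)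

lemma fp_mult_class:
  assumes "u \<in> fp_words X Y" "v \<in> fp_words X Y"
  shows "fp_class X Y u \<otimes>\<^bsub>free_product X Y\<^esub> fp_class X Y v = fp_class X Y (u @ v)"
proof -
  have *: "fp_class X Y (u' @ v') = fp_class X Y (u @ v)"
    if "fp_eq X Y u u'" "fp_eq X Y v v'" for u' v'
  proof -
    have w: "u' \<in> fp_words X Y" "v' \<in> fp_words X Y"
      using that fp_eq_words[OF _ X Y] by blast+
    have "fp_eq X Y (u @ v) (u' @ v)"
      using fp_eq_append[OF that(1), of "[]" v] assms by simp
    moreover have "fp_eq X Y (u' @ v) (u' @ v')"
      using fp_eq_append[OF that(2), of u' "[]"] w by simp
    ultimately have "fp_eq X Y (u @ v) (u' @ v')" by (rule fp_eq.trans)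
    then show ?thesis using w assms fp_class_eq_iff[of "u @ v" "u' @ v'"] by simp
  qed
  have ne: "fp_class X Y u \<noteq> {}" "fp_class X Y v \<noteq> {}"
    using fp_eq.refl[OF assms(1)] fp_eq.refl[OF assms(2)] in_fp_class by blast+
  have "(\<Union>u'\<in>fp_class X Y u. \<Union>v'\<in>fp_class X Y v. fp_class X Y (u' @ v'))
    = (\<Union>u'\<in>fp_class X Y u. \<Union>v'\<in>fp_class X Y v. fp_class X Y (u @ v))"
    by (intro SUP_cong HOL.refl) (simp add: in_fp_class *)
  also have "\<dots> = fp_class X Y (u @ v)"
    using ne by simp
  finally show ?thesis by (simp add: free_product_def)
qed

lemma fp_one_class: "\<one>\<^bsub>free_product X Y\<^esub> = fp_class X Y []"
  by (simp add: free_product_def)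

lemma fp_inverse:
  "w \<in> fp_words X Y \<Longrightarrow> \<exists>v\<in>fp_words X Y. fp_class X Y (v @ w) = fp_class X Y []"
proof (induction w)
  case Nil
  then show ?case by (intro bexI[of _ "[]"]) auto
next
  case (Cons s w)
  then obtain v where v: "v \<in> fp_words X Y" "fp_class X Y (v @ w) = fp_class X Y []"
    and w: "w \<in> fp_words X Y" by auto
  obtain s' where s': "[s'] \<in> fp_words X Y" "fp_eq X Y ([s', s]) []"
  proof (cases s)
    case (Inl a)
    then have a: "a \<in> carrier X" using Cons.prems by auto
    have "fp_eq X Y [Inl (inv\<^bsub>X\<^esub> a), Inl a] []"
      using fp_eq.trans[OF fp_eq.mult_l[of "[]" X Y "[]" "inv\<^bsub>X\<^esub> a" a]] fp_eq.one_l[of "[]" X Y "[]"] a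
      by (simp add: X.l_inv)
    then show ?thesis using that[of "Inl (inv\<^bsub>X\<^esub> a)"] a Inl by auto
  next
    case (Inr a)
    then have a: "a \<in> carrier Y" using Cons.prems by auto
    have "fp_eq X Y [Inr (inv\<^bsub>Y\<^esub> a), Inr a] []"
      using fp_eq.trans[OF fp_eq.mult_r[of "[]" X Y "[]" "inv\<^bsub>Y\<^esub> a" a]] fp_eq.one_r[of "[]" X Y "[]"] a
      by (simp add: Y.l_inv)
    then show ?thesis using that[of "Inr (inv\<^bsub>Y\<^esub> a)"] a Inr by auto
  qed
  have "fp_eq X Y ((v @ [s']) @ s # w) (v @ w)"
    using fp_eq_append[OF s'(2) v(1) w] by simp
  moreover have "fp_eq X Y (v @ w) []"
    using v w fp_class_eq_iff[of "v @ w" "[]"] by simp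
  ultimately have "fp_eq X Y ((v @ [s']) @ s # w) []" by (rule fp_eq.trans)
  then show ?case
    using s' v Cons.prems fp_class_eq_iff[of "(v @ [s']) @ s # w" "[]"]
    by (intro bexI[of _ "v @ [s']"]) auto
qed

lemma group_free_product: "group (free_product X Y)"
proof (rule groupI)
  show "\<one>\<^bsub>free_product X Y\<^esub> \<in> carrier (free_product X Y)"
    unfolding fp_one_class by (rule fp_class_closed) simp
next
  fix A assume "A \<in> carrier (free_product X Y)"
  then obtain u where u: "u \<in> fp_words X Y" and A: "A = fp_class X Y u" by (rule fp_carrierE)
  obtain v where v: "v \<in> fp_words X Y" and vu: "fp_class X Y (v @ u) = fp_class X Y []"
    using fp_inverse[OF u] by blast
  show "\<exists>B\<in>carrier (free_product X Y). B \<otimes>\<^bsub>free_product X Y\<^esub> A = \<one>\<^bsub>free_product X Y\<^esub>"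
    using fp_class_closed[OF v] vu unfolding A fp_one_class fp_mult_class[OF v u, symmetric] by blast
  show "\<one>\<^bsub>free_product X Y\<^esub> \<otimes>\<^bsub>free_product X Y\<^esub> A = A"
    using fp_mult_class[of "[]" u] u unfolding A fp_one_class by simp
  fix B assume "B \<in> carrier (free_product X Y)"
  then obtain v where v: "v \<in> fp_words X Y" and B: "B = fp_class X Y v" by (rule fp_carrierE)
  have uv: "u @ v \<in> fp_words X Y" using u v by simp
  show "A \<otimes>\<^bsub>free_product X Y\<^esub> B \<in> carrier (free_product X Y)"
    unfolding A B fp_mult_class[OF u v] by (rule fp_class_closed[OF uv])
  fix C assume "C \<in> carrier (free_product X Y)"
  then obtain w where w: "w \<in> fp_words X Y" and C: "C = fp_class X Y w" by (rule fp_carrierE)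
  have vw: "v @ w \<in> fp_words X Y" using v w by simp
  show "A \<otimes>\<^bsub>free_product X Y\<^esub> B \<otimes>\<^bsub>free_product X Y\<^esub> C
    = A \<otimes>\<^bsub>free_product X Y\<^esub> (B \<otimes>\<^bsub>free_product X Y\<^esub> C)"
    unfolding A B C fp_mult_class[OF u v] fp_mult_class[OF v w]
      fp_mult_class[OF uv w] fp_mult_class[OF u vw] by simp
qed

lemma fp_inl_hom: "fp_inl X Y \<in> hom X (free_product X Y)"
proof (rule homI)
  fix a b assume ab: "a \<in> carrier X" "b \<in> carrier X"
  have "fp_eq X Y [Inl a, Inl b] [Inl (a \<otimes>\<^bsub>X\<^esub> b)]"
    using fp_eq.mult_l[of "[]" X Y "[]" a b] ab by simp
  then have "fp_class X Y [Inl a, Inl b] = fp_class X Y [Inl (a \<otimes>\<^bsub>X\<^esub> b)]"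
    by (subst fp_class_eq_iff) (use ab in simp_all)
  moreover have "fp_class X Y [Inl a] \<otimes>\<^bsub>free_product X Y\<^esub> fp_class X Y [Inl b] = fp_class X Y ([Inl a] @ [Inl b])"
    by (rule fp_mult_class) (use ab in simp_all)
  ultimately show "fp_inl X Y (a \<otimes>\<^bsub>X\<^esub> b) = fp_inl X Y a \<otimes>\<^bsub>free_product X Y\<^esub> fp_inl X Y b"
    by (simp add: fp_inl_def)
qed (simp add: fp_inl_def fp_class_closed)

lemma fp_inr_hom: "fp_inr X Y \<in> hom Y (free_product X Y)"
proof (rule homI)
  fix a b assume ab: "a \<in> carrier Y" "b \<in> carrier Y"
  have "fp_eq X Y [Inr a, Inr b] [Inr (a \<otimes>\<^bsub>Y\<^esub> b)]"
    using fp_eq.mult_r[of "[]" X Y "[]" a b] ab by simp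
  then have "fp_class X Y [Inr a, Inr b] = fp_class X Y [Inr (a \<otimes>\<^bsub>Y\<^esub> b)]"
    by (subst fp_class_eq_iff) (use ab in simp_all)
  moreover have "fp_class X Y [Inr a] \<otimes>\<^bsub>free_product X Y\<^esub> fp_class X Y [Inr b] = fp_class X Y ([Inr a] @ [Inr b])"
    by (rule fp_mult_class) (use ab in simp_all)
  ultimately show "fp_inr X Y (a \<otimes>\<^bsub>Y\<^esub> b) = fp_inr X Y a \<otimes>\<^bsub>free_product X Y\<^esub> fp_inr X Y b"
    by (simp add: fp_inr_def)
qed (simp add: fp_inr_def fp_class_closed)

context
  fixes Z :: "('c, 'k) monoid_scheme" and f g
  assumes Z: "group Z" and f: "f \<in> hom X Z" and g: "g \<in> hom Y Z"
begin

interpretation Z: group Z by (rule Z)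

lemma case_sum_closed: "s \<in> carrier X <+> carrier Y \<Longrightarrow> case_sum f g s \<in> carrier Z"
  using hom_in_carrier[OF f] hom_in_carrier[OF g] by auto

lemma fp_eval_closed: "w \<in> fp_words X Y \<Longrightarrow> fp_eval Z f g w \<in> carrier Z"
proof (induction w)
  case (Cons s w)
  then have "s \<in> carrier X <+> carrier Y" "w \<in> fp_words X Y" by auto
  then show ?case
    using Cons.IH case_sum_closed[of s] by (simp add: fp_eval_def)
qed (simp add: fp_eval_def)

lemma fp_eval_append:
  "u \<in> fp_words X Y \<Longrightarrow> v \<in> fp_words X Y \<Longrightarrow>
    fp_eval Z f g (u @ v) = fp_eval Z f g u \<otimes>\<^bsub>Z\<^esub> fp_eval Z f g v"
proof (induction u)
  case Nil
  then show ?case using fp_eval_closed[of v] by (simp add: fp_eval_def)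
next
  case (Cons s u)
  then have "s \<in> carrier X <+> carrier Y" "u \<in> fp_words X Y" by auto
  then show ?case
    using Cons.IH Cons.prems case_sum_closed[of s] fp_eval_closed[of u] fp_eval_closed[of v]
    by (simp add: fp_eval_def Z.m_assoc)
qed

lemma fp_eval_Cons: "fp_eval Z f g (s # w) = case_sum f g s \<otimes>\<^bsub>Z\<^esub> fp_eval Z f g w"
  by (simp add: fp_eval_def)

lemma fp_eval_cong: "fp_eq X Y u v \<Longrightarrow> fp_eval Z f g u = fp_eval Z f g v"
proof (induction rule: fp_eq.induct)
  case (mult_l u v a b)
  then show ?case
    using hom_in_carrier[OF f] fp_eval_closed[of v]
    by (simp add: fp_eval_append fp_eval_Cons hom_mult[OF f] Z.m_assoc)
next
  case (mult_r u v a b)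
  then show ?case
    using hom_in_carrier[OF g] fp_eval_closed[of v]
    by (simp add: fp_eval_append fp_eval_Cons hom_mult[OF g] Z.m_assoc)
next
  case (one_l u v)
  then show ?case
    using fp_eval_closed[of v] hom_one[OF f X Z]
    by (simp add: fp_eval_append fp_eval_Cons)
next
  case (one_r u v)
  then show ?case
    using fp_eval_closed[of v] hom_one[OF g Y Z]
    by (simp add: fp_eval_append fp_eval_Cons)
qed auto

lemma fp_copair_class:
  assumes "w \<in> fp_words X Y"
  shows "fp_copair Z f g (fp_class X Y w) = fp_eval Z f g w"
proof -
  have "fp_eval Z f g ` fp_class X Y w = {fp_eval Z f g w}"
    using assms fp_eval_cong by (auto simp: in_fp_class intro!: image_eqI[of _ _ w] intro: fp_eq.refl)
  then show ?thesis by (simp add: fp_copair_def)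
qed

lemma fp_copair_hom: "fp_copair Z f g \<in> hom (free_product X Y) Z"
  by (rule homI; elim fp_carrierE)
    (simp_all add: fp_copair_class fp_mult_class fp_eval_append fp_eval_closed)

lemma fp_copair_inl: "x \<in> carrier X \<Longrightarrow> fp_copair Z f g (fp_inl X Y x) = f x"
  using hom_in_carrier[OF f]
  by (simp add: fp_inl_def fp_copair_class fp_eval_def)

lemma fp_copair_inr: "y \<in> carrier Y \<Longrightarrow> fp_copair Z f g (fp_inr X Y y) = g y"
  using hom_in_carrier[OF g]
  by (simp add: fp_inr_def fp_copair_class fp_eval_def)

lemma fp_copair_unique:
  assumes h: "h \<in> hom (free_product X Y) Z"
    and "\<And>x. x \<in> carrier X \<Longrightarrow> h (fp_inl X Y x) = f x"
    and "\<And>y. y \<in> carrier Y \<Longrightarrow> h (fp_inr X Y y) = g y"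
    and A: "A \<in> carrier (free_product X Y)"
  shows "h A = fp_copair Z f g A"
proof -
  have "h (fp_class X Y w) = fp_eval Z f g w" if "w \<in> fp_words X Y" for w
    using that
  proof (induction w)
    case Nil
    show ?case
      using hom_one[OF h group_free_product Z] by (simp add: fp_one_class fp_eval_def)
  next
    case (Cons s w)
    then have s: "s \<in> carrier X <+> carrier Y" and w: "w \<in> fp_words X Y" by auto
    have "h (fp_class X Y ([s] @ w)) = h (fp_class X Y [s]) \<otimes>\<^bsub>Z\<^esub> h (fp_class X Y w)"
      using s w hom_mult[OF h fp_class_closed[of "[s]"] fp_class_closed[of w]]
      by (simp add: fp_mult_class)
    moreover have "h (fp_class X Y [s]) = case_sum f g s"
      using s assms(2,3) by (auto simp: fp_inl_def fp_inr_def)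
    ultimately show ?case
      using Cons.IH by (simp add: fp_eval_Cons)
  qed
  then show ?thesis using A by (elim fp_carrierE) (simp add: fp_copair_class)
qed

end

end

lemma exists_direct_product:
  fixes Y :: "('u::infinite) monoid"
  assumes "group Y"
  shows "\<exists>(P :: 'u monoid) h. group P \<and> h \<in> iso P (Y \<times>\<times> Y)"
proof -
  interpret YY: group "Y \<times>\<times> Y" using assms by (intro DirProd_group)
  have "(card_of ((UNIV :: 'u set) \<times> (UNIV :: 'u set)), card_of (UNIV :: 'u set)) \<in> ordIso"
    by (rule card_of_Times_same_infinite) (rule infinite_UNIV)
  then obtain e :: "'u \<times> 'u \<Rightarrow> 'u" where e: "bij e"
    by (auto simp flip: card_of_ordIso)
  define P :: "'u monoid" where "P =
    \<lparr>carrier = e ` carrier (Y \<times>\<times> Y),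
     mult = (\<lambda>a b. e (inv_into UNIV e a \<otimes>\<^bsub>Y \<times>\<times> Y\<^esub> inv_into UNIV e b)), one = e \<one>\<^bsub>Y \<times>\<times> Y\<^esub>\<rparr>"
  have inv_e: "inv_into UNIV e (e z) = z" for z using e by (simp add: bij_is_inj)
  have "e \<in> iso (Y \<times>\<times> Y) P"
    by (rule isoI) (auto simp: hom_def P_def inv_e bij_betw_def intro: inj_on_subset[OF bij_is_inj[OF e]])
  moreover from this have "group P"
    using YY.iso_imp_img_group[of e P] by (simp add: P_def)
  ultimately show ?thesis using YY.iso_set_sym by blast
qed

end

theory Submission
  imports Defs "HOL-Algebra.Elementary_Groups" "HOL-Library.Nat_Bijection"
begin

text \<open>
  A natural imaginary splitting \<open>t\<close> is determined by a single word. If \<open>Z\<close> is infinite cyclic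
  with generator \<open>u\<close>, then any pair \<open>(x, y)\<close> of elements of a group \<open>G\<close> is the image of \<open>(u, u)\<close>
  under a pair of homomorphisms \<open>Z \<rightarrow> G\<close>, so naturality makes \<open>\<mu> (x, y)\<close> the value at \<open>(x, y)\<close> of
  the word \<open>t Z Z (u, u)\<close> in the free group \<open>Z + Z\<close> (\<open>imaginary_addition_hom_images\<close>).

  In a 2-Engel group the commutator \<open>c = [x, y]\<close> commutes with \<open>x\<close> and with \<open>y\<close>. Words in \<open>x\<close> and
  \<open>y\<close> can therefore be collected to \<open>x^i y^j c^n\<close>, and the exponents depend on the word only
  (\<open>word_normal_form\<close>). The condition \<open>r t = id\<close> gives \<open>\<mu> (x, 1) = x\<close> and \<open>\<mu> (1, y) = y\<close>, which says
  \<open>x^i = x\<close> and \<open>y^j = y\<close>. So there is one integer \<open>n\<close> with \<open>\<mu> (x, y) = x y [x, y]^n\<close> in all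
  2-Engel groups (\<open>two_engel_imaginary_addition\<close>).

  By naturality along the two projections, \<open>\<mu>\<close> on \<open>Y \<times> Y\<close> is computed coordinatewise, and the
  equations for \<open>q\<close> in the split epimorphism \<open>\<pi>\<^sub>2\<close> say that \<open>q (-, y)\<close> is a two-sided inverse of
  the map \<open>a \<mapsto> \<mu> (a, y) = a y [a, y]^n\<close>. Since \<open>[a z, y] = [a, y]\<close> whenever \<open>z\<close> commutes with
  \<open>y\<close>, this map does not change the commutator with \<open>y\<close>, and its inverse is
  \<open>x \<mapsto> x y\<inverse> [x, y]^(-n)\<close> (\<open>twisted_translation_inverse\<close>).
\<close>

section \<open>Commutators in a group\<close>

lemma (in group) mult_inv_cancel_left [simp]:
  assumes "a \<in> carrier G" "b \<in> carrier G"
  shows "a \<otimes> (inv a \<otimes> b) = b" and "inv a \<otimes> (a \<otimes> b) = b"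
  using assms by (simp_all flip: m_assoc)

lemma (in group) int_pow_conj:
  assumes "a \<in> carrier G" "g \<in> carrier G"
  shows "g \<otimes> a [^] (i::int) \<otimes> inv g = (g \<otimes> a \<otimes> inv g) [^] i"
proof -
  have "(\<lambda>a. g \<otimes> a \<otimes> inv g) \<in> hom G G"
    using assms by (intro homI) (auto simp: m_assoc)
  from hom_int_pow[OF this _ is_group is_group] assms show ?thesis by simp
qed

lemma (in group) int_pow_commute:
  assumes "a \<in> carrier G" "g \<in> carrier G" and "g \<otimes> a = a \<otimes> g"
  shows "g \<otimes> a [^] (i::int) = a [^] i \<otimes> g"
proof -
  have "g \<otimes> a \<otimes> inv g = a" using assms by (simp add: m_assoc)
  with int_pow_conj[OF assms(1,2), of i] show ?thesis
    using assms(1,2) by (simp add: inv_solve_right')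
qed

lemma (in group) commutator_closed [simp]:
  "x \<in> carrier G \<Longrightarrow> y \<in> carrier G \<Longrightarrow> commutator G x y \<in> carrier G"
  by (simp add: commutator_def)

lemma (in group) commutator_eq_one_iff:
  assumes "x \<in> carrier G" "y \<in> carrier G"
  shows "commutator G x y = \<one> \<longleftrightarrow> x \<otimes> y = y \<otimes> x"
  using assms unfolding commutator_def by (metis inv_solve_right' l_one m_closed inv_closed one_closed)

lemma (in group) inv_commutator:
  assumes "x \<in> carrier G" "y \<in> carrier G"
  shows "inv (commutator G x y) = commutator G y x"
  using assms by (simp add: commutator_def inv_mult_group m_assoc)

text \<open>In \<open>x z y z\<inverse> x\<inverse> y\<inverse>\<close> the middle factor \<open>z y z\<inverse>\<close> is just \<open>y\<close>.\<close>

lemma (in group) commutator_mult_commuting: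
  assumes "x \<in> carrier G" "y \<in> carrier G" "z \<in> carrier G" and "z \<otimes> y = y \<otimes> z"
  shows "commutator G (x \<otimes> z) y = commutator G x y"
proof -
  have "z \<otimes> (y \<otimes> (inv z \<otimes> u)) = y \<otimes> u" if "u \<in> carrier G" for u
    using assms that by (metis inv_closed m_assoc m_closed mult_inv_cancel_left(1))
  then show ?thesis using assms(1-3)
    by (simp add: commutator_def inv_mult_group m_assoc)
qed

section \<open>2-Engel groups\<close>

locale two_engel = group +
  assumes engel: "\<lbrakk>x \<in> carrier G; y \<in> carrier G\<rbrakk> \<Longrightarrow> commutator G (commutator G x y) y = \<one>"

lemma two_engel_iff: "two_engel G \<longleftrightarrow> two_engel_group G"
  by (auto simp: two_engel_def two_engel_axioms_def two_engel_group_def)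

context two_engel
begin

lemma commutator_commutes_right:
  assumes "x \<in> carrier G" "y \<in> carrier G"
  shows "y \<otimes> commutator G x y = commutator G x y \<otimes> y"
  using engel[OF assms] commutator_eq_one_iff[of "commutator G x y" y] assms by simp

text \<open>
  The collection step. Conjugation by \<open>y\<close> sends \<open>x\<close> to \<open>x c\<inverse>\<close>, hence \<open>x^i\<close> to \<open>x^i c^(-i)\<close>,
  because \<open>c\<close> commutes with \<open>x\<close>. Read the other way round, conjugation by \<open>x^(-i)\<close> sends \<open>y\<close> to
  \<open>y c^(-i)\<close>, hence \<open>y^l\<close> to \<open>y^l c^(-i l)\<close>, because \<open>c\<close> commutes with \<open>y\<close>.
\<close>

lemma int_pow_swap:
  fixes i l :: int
  assumes x: "x \<in> carrier G" and y: "y \<in> carrier G"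
  defines "c \<equiv> commutator G x y"
  shows "y [^] l \<otimes> x [^] i = x [^] i \<otimes> (y [^] l \<otimes> c [^] (- (i * l)))"
proof -
  have c: "c \<in> carrier G" using x y by (simp add: c_def)
  \<comment> \<open>This is the Engel identity for the swapped pair, since \<open>[y, x] = c\<inverse>\<close>.\<close>
  have cx: "x \<otimes> inv c = inv c \<otimes> x"
    using commutator_commutes_right[OF y x] x y by (simp add: c_def inv_commutator)
  have cy: "y \<otimes> c [^] n = c [^] n \<otimes> y" for n :: int
    using int_pow_commute[OF c y] commutator_commutes_right[OF x y] by (simp add: c_def)
  have "y \<otimes> x \<otimes> inv y = inv c \<otimes> x"
    using x y unfolding c_def inv_commutator[OF x y] by (simp add: commutator_def m_assoc)
  then have "y \<otimes> x [^] i \<otimes> inv y = (x \<otimes> inv c) [^] i"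
    unfolding cx using int_pow_conj[OF x y] by simp
  also have "\<dots> = x [^] i \<otimes> c [^] (- i)"
    using int_pow_mult_distrib[OF cx x inv_closed[OF c]] c by (simp add: int_pow_inv int_pow_neg)
  finally have "y \<otimes> x [^] i = x [^] i \<otimes> c [^] (- i) \<otimes> y"
    using x y c by (simp add: inv_solve_right')
  then have "inv (x [^] i) \<otimes> y \<otimes> x [^] i = y \<otimes> c [^] (- i)"
    using x y c cy[of "- i"] by (simp add: m_assoc)
  moreover have "(y \<otimes> c [^] (- i)) [^] l = y [^] l \<otimes> c [^] (- (i * l))"
    using int_pow_mult_distrib[OF cy y] y c by (simp add: int_pow_pow)
  ultimately have "inv (x [^] i) \<otimes> y [^] l \<otimes> x [^] i = y [^] l \<otimes> c [^] (- (i * l))"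
    using int_pow_conj[of y "inv (x [^] i)" l] x y by simp
  then show ?thesis using x y c by (simp add: m_assoc inv_solve_left')
qed

lemma commutator_mult_pow:
  fixes i n :: int
  assumes "x \<in> carrier G" "y \<in> carrier G"
  shows "commutator G (x \<otimes> (y [^] i \<otimes> commutator G x y [^] n)) y = commutator G x y"
proof (rule commutator_mult_commuting)
  let ?c = "commutator G x y"
  have "y \<otimes> ?c [^] n = ?c [^] n \<otimes> y"
    using assms int_pow_commute[OF _ _ commutator_commutes_right[OF assms]] by simp
  moreover have "y \<otimes> y [^] i = y [^] i \<otimes> y" using assms int_pow_commute by simp
  ultimately show "y [^] i \<otimes> ?c [^] n \<otimes> y = y \<otimes> (y [^] i \<otimes> ?c [^] n)"
    using assms by (metis commutator_closed int_pow_closed m_assoc)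
qed (use assms in auto)

text \<open>
  Both maps multiply \<open>a\<close> on the right by an element that commutes with \<open>y\<close>, so neither changes
  \<open>[a, y]\<close>; with this commutator fixed, the two right factors are inverse to each other.
\<close>

lemma twisted_translation_inverse:
  fixes n :: int
  defines "\<phi> \<equiv> \<lambda>a y. a \<otimes> (y \<otimes> commutator G a y [^] n)"
    and "\<psi> \<equiv> \<lambda>a y. a \<otimes> (inv y \<otimes> commutator G a y [^] (- n))"
  assumes a: "a \<in> carrier G" and y: "y \<in> carrier G"
  shows "\<phi> (\<psi> a y) y = a" and "\<psi> (\<phi> a y) y = a"
proof -
  let ?c = "commutator G a y"
  have comm: "commutator G (\<psi> a y) y = ?c" "commutator G (\<phi> a y) y = ?c"
    using commutator_mult_pow[OF a y, of "-1" "- n"] commutator_mult_pow[OF a y, of 1 n] a y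
    by (simp_all add: \<phi>_def \<psi>_def int_pow_neg)
  have y_c: "y \<otimes> ?c [^] k = ?c [^] k \<otimes> y" for k :: int
    using a y int_pow_commute[OF _ _ commutator_commutes_right[OF a y]] by simp
  have "inv y \<otimes> ?c [^] (- n) \<otimes> (y \<otimes> ?c [^] n) = inv y \<otimes> (?c [^] (- n) \<otimes> y) \<otimes> ?c [^] n"
    using a y by (simp add: m_assoc)
  also have "\<dots> = inv y \<otimes> y \<otimes> (?c [^] (- n) \<otimes> ?c [^] n)"
    using a y by (simp add: m_assoc flip: y_c)
  also have "\<dots> = \<one>"
    using a y by (simp flip: int_pow_mult)
  finally have 1: "inv y \<otimes> ?c [^] (- n) \<otimes> (y \<otimes> ?c [^] n) = \<one>" .
  show "\<phi> (\<psi> a y) y = a"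
    using arg_cong[OF 1, of "\<lambda>z. a \<otimes> z"] a y comm(1) unfolding \<phi>_def by (simp add: \<psi>_def m_assoc)
  have 2: "y \<otimes> ?c [^] n \<otimes> (inv y \<otimes> ?c [^] (- n)) = \<one>"
    using inv_comm[OF 1] a y by simp
  show "\<psi> (\<phi> a y) y = a"
    using arg_cong[OF 2, of "\<lambda>z. a \<otimes> z"] a y comm(2) unfolding \<psi>_def by (simp add: \<phi>_def m_assoc)
qed

end

text \<open>
  A word over \<open>'a + 'a\<close> is evaluated here by sending a letter \<open>a\<close> of the left copy to \<open>x^(d a)\<close> and
  one of the right copy to \<open>y^(d a)\<close>. The quantifiers have the exponents before the group and its
  elements: one triple of exponents serves all evaluations of the word at once. A letter from the
  left adds to \<open>i\<close>; a letter from the right has to pass \<open>x^i\<close>, which costs a power of the commutator.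
\<close>

lemma word_normal_form:
  fixes d :: "'a \<Rightarrow> int" and w :: "('a + 'a) list"
  shows "\<exists>(i :: int) (j :: int) (n :: int). \<forall>(G :: ('g, 'h) monoid_scheme) x y.
    two_engel G \<longrightarrow> x \<in> carrier G \<longrightarrow> y \<in> carrier G \<longrightarrow>
      fp_eval G (\<lambda>a. x [^]\<^bsub>G\<^esub> d a) (\<lambda>a. y [^]\<^bsub>G\<^esub> d a) w =
      x [^]\<^bsub>G\<^esub> i \<otimes>\<^bsub>G\<^esub> (y [^]\<^bsub>G\<^esub> j \<otimes>\<^bsub>G\<^esub> commutator G x y [^]\<^bsub>G\<^esub> n)"
proof (induction w)
  case Nil
  show ?case
    by (intro exI[of _ 0] allI impI) (simp add: fp_eval_def two_engel_def group.is_monoid)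
next
  case (Cons s w)
  then obtain i j n :: int where IH:
    "\<And>(G :: ('g, 'h) monoid_scheme) x y. \<lbrakk>two_engel G; x \<in> carrier G; y \<in> carrier G\<rbrakk> \<Longrightarrow>
      fp_eval G (\<lambda>a. x [^]\<^bsub>G\<^esub> d a) (\<lambda>a. y [^]\<^bsub>G\<^esub> d a) w =
      x [^]\<^bsub>G\<^esub> i \<otimes>\<^bsub>G\<^esub> (y [^]\<^bsub>G\<^esub> j \<otimes>\<^bsub>G\<^esub> commutator G x y [^]\<^bsub>G\<^esub> n)"
    by blast
  show ?case
  proof (cases s)
    case (Inl a)
    show ?thesis
    proof (rule exI[of _ "d a + i"], rule exI[of _ j], rule exI[of _ n], intro allI impI)
      fix G :: "('g, 'h) monoid_scheme" and x y
      assume G: "two_engel G" and xy: "x \<in> carrier G" "y \<in> carrier G"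
      interpret two_engel G by (rule G)
      show "fp_eval G (\<lambda>a. x [^]\<^bsub>G\<^esub> d a) (\<lambda>a. y [^]\<^bsub>G\<^esub> d a) (s # w) =
        x [^]\<^bsub>G\<^esub> (d a + i) \<otimes>\<^bsub>G\<^esub> (y [^]\<^bsub>G\<^esub> j \<otimes>\<^bsub>G\<^esub> commutator G x y [^]\<^bsub>G\<^esub> n)"
        using IH[OF G xy] xy by (simp add: fp_eval_def Inl int_pow_mult m_assoc)
    qed
  next
    case (Inr a)
    show ?thesis
    proof (rule exI[of _ i], rule exI[of _ "d a + j"], rule exI[of _ "n - i * d a"], intro allI impI)
      fix G :: "('g, 'h) monoid_scheme" and x y
      assume G: "two_engel G" and xy: "x \<in> carrier G" "y \<in> carrier G"
      interpret two_engel G by (rule G)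
      define c where "c = commutator G x y"
      have c: "c \<in> carrier G" using xy by (simp add: c_def)
      have "y \<otimes>\<^bsub>G\<^esub> c [^]\<^bsub>G\<^esub> m = c [^]\<^bsub>G\<^esub> m \<otimes>\<^bsub>G\<^esub> y" for m :: int
        using int_pow_commute[OF c xy(2)] commutator_commutes_right[OF xy] by (simp add: c_def)
      then have yc: "c [^]\<^bsub>G\<^esub> m \<otimes>\<^bsub>G\<^esub> y [^]\<^bsub>G\<^esub> k = y [^]\<^bsub>G\<^esub> k \<otimes>\<^bsub>G\<^esub> c [^]\<^bsub>G\<^esub> m" for m k :: int
        using int_pow_commute[OF xy(2), of "c [^]\<^bsub>G\<^esub> m" k] c by simp
      have "fp_eval G (\<lambda>a. x [^]\<^bsub>G\<^esub> d a) (\<lambda>a. y [^]\<^bsub>G\<^esub> d a) (s # w) =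
        y [^]\<^bsub>G\<^esub> d a \<otimes>\<^bsub>G\<^esub> x [^]\<^bsub>G\<^esub> i \<otimes>\<^bsub>G\<^esub> (y [^]\<^bsub>G\<^esub> j \<otimes>\<^bsub>G\<^esub> c [^]\<^bsub>G\<^esub> n)"
        using IH[OF G xy] xy c by (simp add: fp_eval_def Inr c_def m_assoc)
      also have "\<dots> = x [^]\<^bsub>G\<^esub> i \<otimes>\<^bsub>G\<^esub> (y [^]\<^bsub>G\<^esub> d a \<otimes>\<^bsub>G\<^esub>
        (c [^]\<^bsub>G\<^esub> (- (i * d a)) \<otimes>\<^bsub>G\<^esub> y [^]\<^bsub>G\<^esub> j) \<otimes>\<^bsub>G\<^esub> c [^]\<^bsub>G\<^esub> n)"
        using int_pow_swap[OF xy, of "d a" i, folded c_def] xy c by (simp add: m_assoc)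
      also have "\<dots> = x [^]\<^bsub>G\<^esub> i \<otimes>\<^bsub>G\<^esub> (y [^]\<^bsub>G\<^esub> d a \<otimes>\<^bsub>G\<^esub> y [^]\<^bsub>G\<^esub> j \<otimes>\<^bsub>G\<^esub>
        (c [^]\<^bsub>G\<^esub> (- (i * d a)) \<otimes>\<^bsub>G\<^esub> c [^]\<^bsub>G\<^esub> n))"
        unfolding yc using xy c by (simp add: m_assoc)
      also have "\<dots> = x [^]\<^bsub>G\<^esub> i \<otimes>\<^bsub>G\<^esub> (y [^]\<^bsub>G\<^esub> (d a + j) \<otimes>\<^bsub>G\<^esub> c [^]\<^bsub>G\<^esub> (n - i * d a))"
        using xy c int_pow_mult[of c "- (i * d a)" n] int_pow_mult[of y "d a" j] by simp
      finally show "fp_eval G (\<lambda>a. x [^]\<^bsub>G\<^esub> d a) (\<lambda>a. y [^]\<^bsub>G\<^esub> d a) (s # w) =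
        x [^]\<^bsub>G\<^esub> i \<otimes>\<^bsub>G\<^esub> (y [^]\<^bsub>G\<^esub> (d a + j) \<otimes>\<^bsub>G\<^esub>
          commutator G x y [^]\<^bsub>G\<^esub> (n - i * d a))"
        unfolding c_def .
    qed
  qed
qed


section \<open>Homomorphisms out of a free product\<close>

lemma fp_map_hom:
  assumes "group A" "group B" "group A'" "group B'" "f \<in> hom A A'" "g \<in> hom B B'"
  shows "fp_map A' B' f g \<in> hom (free_product A B) (free_product A' B')"
  unfolding fp_map_def using assms
  by (intro fp_copair_hom group_free_product hom_compose[OF assms(5)] hom_compose[OF assms(6)]
      fp_inl_hom fp_inr_hom)

lemma fp_map_inl:
  assumes "group A" "group B" "group A'" "group B'" "f \<in> hom A A'" "g \<in> hom B B'"
    and "a \<in> carrier A"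
  shows "fp_map A' B' f g (fp_inl A B a) = fp_inl A' B' (f a)"
  unfolding fp_map_def using assms
  by (subst fp_copair_inl) (auto intro: group_free_product hom_compose fp_inl_hom fp_inr_hom)

lemma fp_map_inr:
  assumes "group A" "group B" "group A'" "group B'" "f \<in> hom A A'" "g \<in> hom B B'"
    and "b \<in> carrier B"
  shows "fp_map A' B' f g (fp_inr A B b) = fp_inr A' B' (g b)"
  unfolding fp_map_def using assms
  by (subst fp_copair_inr) (auto intro: group_free_product hom_compose fp_inl_hom fp_inr_hom)

lemma hom_fp_copair:
  assumes "group A" "group B" "group Z" "group Z'"
    and f: "f \<in> hom A Z" and g: "g \<in> hom B Z" and h: "h \<in> hom Z Z'"
    and p: "p \<in> carrier (free_product A B)"
  shows "h (fp_copair Z f g p) = fp_copair Z' (h \<circ> f) (h \<circ> g) p"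
proof -
  have "(h \<circ> fp_copair Z f g) p = fp_copair Z' (h \<circ> f) (h \<circ> g) p"
    using assms
    by (intro fp_copair_unique[OF _ _ _ hom_compose[OF f h] hom_compose[OF g h] _ _ _ p]
        hom_compose[OF fp_copair_hom h]) (simp_all add: fp_copair_inl fp_copair_inr)
  then show ?thesis by simp
qed

lemma codiagonal_fp_map:
  assumes "group A" "group B" "group Z" "f \<in> hom A Z" "g \<in> hom B Z"
    and p: "p \<in> carrier (free_product A B)"
  shows "codiagonal Z (fp_map Z Z f g p) = fp_copair Z f g p"
proof -
  have id: "(\<lambda>z. z) \<in> hom Z Z" by (rule homI) auto
  have "(codiagonal Z \<circ> fp_map Z Z f g) p = fp_copair Z f g p"
  proof (rule fp_copair_unique[OF assms(1-5) _ _ _ p])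
    show "codiagonal Z \<circ> fp_map Z Z f g \<in> hom (free_product A B) Z"
      unfolding codiagonal_def using assms id by (intro hom_compose[OF fp_map_hom fp_copair_hom])
  qed (use assms(1-5) id in \<open>auto simp: codiagonal_def fp_map_inl fp_map_inr fp_copair_inl
      fp_copair_inr dest: hom_in_carrier\<close>)
  then show ?thesis by simp
qed

section \<open>The imaginary addition of a natural imaginary splitting\<close>

context
  fixes t :: "('u::infinite) imaginary_family"
  assumes t: "natural_imaginary_splitting t"
begin

lemma splitting_closed:
  "\<lbrakk>group A; group B; a \<in> carrier A; b \<in> carrier B\<rbrakk> \<Longrightarrow> t A B (a, b) \<in> carrier (free_product A B)"
  using t unfolding natural_imaginary_splitting_def by blast

text \<open>
  Naturality turns the value of \<open>t\<close> at an arbitrary pair into the image of its value at a chosen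
  one. For \<open>A = B\<close> infinite cyclic this reads \<open>\<mu>\<close> off from a single word; the other instances give
  the naturality of \<open>\<mu>\<close> and its unit laws.
\<close>

lemma imaginary_addition_hom_images:
  assumes "group A" "group B" "group Z" "f \<in> hom A Z" "g \<in> hom B Z" "a \<in> carrier A" "b \<in> carrier B"
  shows "imaginary_addition t Z (f a, g b) = fp_copair Z f g (t A B (a, b))"
proof -
  have "t Z Z (f a, g b) = fp_map Z Z f g (t A B (a, b))"
    using t assms unfolding natural_imaginary_splitting_def by metis
  then show ?thesis
    using assms by (simp add: imaginary_addition_def codiagonal_fp_map splitting_closed)
qed

lemma hom_imaginary_addition:
  assumes "group X" "group Z" "h \<in> hom X Z" "x \<in> carrier X" "y \<in> carrier X"
  shows "h (imaginary_addition t X (x, y)) = imaginary_addition t Z (h x, h y)"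
proof -
  have id: "(\<lambda>z. z) \<in> hom X X" by (rule homI) auto
  have "h (imaginary_addition t X (x, y)) = fp_copair Z h h (t X X (x, y))"
    unfolding imaginary_addition_def codiagonal_def comp_apply
    by (rule hom_fp_copair[OF assms(1,1,1,2) id id assms(3) splitting_closed[OF assms(1,1,4,5)],
          unfolded comp_def])
  then show ?thesis
    using assms by (simp add: imaginary_addition_hom_images)
qed

lemma imaginary_addition_closed:
  assumes "group X" "x \<in> carrier X" "y \<in> carrier X"
  shows "imaginary_addition t X (x, y) \<in> carrier X"
proof -
  have id: "(\<lambda>z. z) \<in> hom X X" by (rule homI) auto
  show ?thesis
    unfolding imaginary_addition_def codiagonal_def comp_apply
    using assms(1) id splitting_closed[OF assms(1,1,2,3)] by (intro hom_in_carrier[OF fp_copair_hom])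
qed

text \<open>
  The pair \<open>(1, x)\<close> is the image of \<open>(x, x)\<close> under the trivial homomorphism and the identity, and
  the homomorphism \<open>[1, id] : X + X \<rightarrow> X\<close> is the second coordinate of \<open>r : X + X \<rightarrow> X \<times> X\<close>.
  So \<open>\<mu> (1, x)\<close> is the second coordinate of \<open>r (t (x, x)) = (x, x)\<close>.
\<close>

lemma imaginary_addition_one:
  assumes X: "group X" and x: "x \<in> carrier X"
  shows imaginary_addition_one_left: "imaginary_addition t X (\<one>\<^bsub>X\<^esub>, x) = x"
    and imaginary_addition_one_right: "imaginary_addition t X (x, \<one>\<^bsub>X\<^esub>) = x"
proof -
  interpret group X by (rule X)
  have XX: "group (X \<times>\<times> X)" using X by (intro DirProd_group)
  have id: "(\<lambda>z. z) \<in> hom X X" by (rule homI) auto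
  have one: "(\<lambda>_. \<one>\<^bsub>X\<^esub>) \<in> hom X X" by (rule homI) auto
  have inj: "(\<lambda>z. (z, \<one>\<^bsub>X\<^esub>)) \<in> hom X (X \<times>\<times> X)" "(\<lambda>z. (\<one>\<^bsub>X\<^esub>, z)) \<in> hom X (X \<times>\<times> X)"
    by (auto intro!: homI)
  have pr: "fst \<in> hom (X \<times>\<times> X) X" "snd \<in> hom (X \<times>\<times> X) X"
    by (auto intro!: homI)
  have r: "fp_to_prod X X (t X X (x, x)) = (x, x)"
    using t X x unfolding natural_imaginary_splitting_def by blast
  have T: "t X X (x, x) \<in> carrier (free_product X X)"
    using splitting_closed X x by blast
  have "imaginary_addition t X (\<one>\<^bsub>X\<^esub>, x) = fp_copair X (\<lambda>_. \<one>\<^bsub>X\<^esub>) (\<lambda>z. z) (t X X (x, x))"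
    using imaginary_addition_hom_images[OF X X X one id x x] .
  also have "\<dots> = snd (fp_to_prod X X (t X X (x, x)))"
    unfolding fp_to_prod_def hom_fp_copair[OF X X XX X inj pr(2) T] by (simp add: comp_def)
  finally show "imaginary_addition t X (\<one>\<^bsub>X\<^esub>, x) = x" by (simp add: r)
  have "imaginary_addition t X (x, \<one>\<^bsub>X\<^esub>) = fp_copair X (\<lambda>z. z) (\<lambda>_. \<one>\<^bsub>X\<^esub>) (t X X (x, x))"
    using imaginary_addition_hom_images[OF X X X id one x x] .
  also have "\<dots> = fst (fp_to_prod X X (t X X (x, x)))"
    unfolding fp_to_prod_def hom_fp_copair[OF X X XX X inj pr(1) T] by (simp add: comp_def)
  finally show "imaginary_addition t X (x, \<one>\<^bsub>X\<^esub>) = x" by (simp add: r)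
qed

end

text \<open>
  The splitting only sees groups with carrier in \<open>'u\<close>, so the integers have to be transported into
  this type along an injection.
\<close>

lemma infinite_cyclic_group_copy:
  obtains Z :: "('u::infinite) monoid" and d :: "'u \<Rightarrow> int"
  where "group Z" "d \<in> iso Z integer_group"
proof -
  interpret ZZ: group integer_group by simp
  obtain e' :: "nat \<Rightarrow> 'u" where "inj e'"
    using infinite_countable_subset[OF infinite_UNIV] by blast
  define e where "e = e' \<circ> int_encode"
  have e: "inj e"
    unfolding e_def using \<open>inj e'\<close> by (intro inj_compose inj_int_encode)
  have inv_e: "inv_into UNIV e (e k) = k" for k using e by simp
  define Z :: "'u monoid" where
    "Z = \<lparr>carrier = range e, mult = (\<lambda>a b. e (inv_into UNIV e a + inv_into UNIV e b)), one = e 0\<rparr>"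
  have iso: "e \<in> iso integer_group Z"
    by (rule isoI) (use e in \<open>auto simp: hom_def Z_def inv_e bij_betw_def\<close>)
  then have "group Z"
    using ZZ.iso_imp_img_group[of e Z] by (simp add: Z_def)
  then show thesis using that ZZ.iso_set_sym[OF iso] by blast
qed

text \<open>
  The integer \<open>n\<close> belongs to the word \<open>t Z Z (u, u)\<close>. That it is the same for all \<open>x\<close> is what makes
  the map \<open>x \<mapsto> \<mu> (x, y)\<close> invertible by an explicit formula.
\<close>

lemma two_engel_imaginary_addition:
  fixes t :: "('u::infinite) imaginary_family"
  assumes t: "natural_imaginary_splitting t"
  shows "\<exists>n :: int. \<forall>G x y. two_engel G \<longrightarrow> x \<in> carrier G \<longrightarrow> y \<in> carrier G \<longrightarrow>
      imaginary_addition t G (x, y) = x \<otimes>\<^bsub>G\<^esub> (y \<otimes>\<^bsub>G\<^esub> commutator G x y [^]\<^bsub>G\<^esub> n)"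
proof -
  obtain Z :: "'u monoid" and d where Z: "group Z" and d: "d \<in> iso Z integer_group"
    by (rule infinite_cyclic_group_copy)
  have d_hom: "d \<in> hom Z integer_group" using d by (simp add: iso_def)
  have "1 \<in> d ` carrier Z" using d by (simp add: iso_def bij_betw_def)
  then obtain u where u: "u \<in> carrier Z" "d u = 1" by auto
  obtain w where w: "w \<in> fp_words Z Z" and tw: "t Z Z (u, u) = fp_class Z Z w"
    using fp_carrierE[OF Z Z splitting_closed[OF t Z Z u(1) u(1)]] .
  obtain i j n :: int where nf:
    "\<And>(G :: 'u monoid) x y. \<lbrakk>two_engel G; x \<in> carrier G; y \<in> carrier G\<rbrakk> \<Longrightarrow>
      fp_eval G (\<lambda>a. x [^]\<^bsub>G\<^esub> d a) (\<lambda>a. y [^]\<^bsub>G\<^esub> d a) w =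
      x [^]\<^bsub>G\<^esub> i \<otimes>\<^bsub>G\<^esub> (y [^]\<^bsub>G\<^esub> j \<otimes>\<^bsub>G\<^esub> commutator G x y [^]\<^bsub>G\<^esub> n)"
    using word_normal_form[where ?'g = 'u and ?'h = unit, of d w] by blast
  show ?thesis
  proof (intro exI[of _ n] allI impI)
    fix G :: "'u monoid" and x y
    assume G: "two_engel G" and x: "x \<in> carrier G" and y: "y \<in> carrier G"
    interpret two_engel G by (rule G)
    have form: "imaginary_addition t G (a, b) =
      a [^]\<^bsub>G\<^esub> i \<otimes>\<^bsub>G\<^esub> (b [^]\<^bsub>G\<^esub> j \<otimes>\<^bsub>G\<^esub> commutator G a b [^]\<^bsub>G\<^esub> n)"
      if a: "a \<in> carrier G" and b: "b \<in> carrier G" for a b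
    proof -
      have pow: "(\<lambda>z. g [^]\<^bsub>G\<^esub> d z) \<in> hom Z G" if "g \<in> carrier G" for g
        using Group.hom_compose[OF d_hom hom_integer_group_pow[OF that]] by (simp add: comp_def)
      have "imaginary_addition t G (a [^]\<^bsub>G\<^esub> d u, b [^]\<^bsub>G\<^esub> d u) =
        fp_eval G (\<lambda>z. a [^]\<^bsub>G\<^esub> d z) (\<lambda>z. b [^]\<^bsub>G\<^esub> d z) w"
        using imaginary_addition_hom_images[OF t Z Z is_group pow[OF a] pow[OF b] u(1) u(1)]
          fp_copair_class[OF Z Z is_group pow[OF a] pow[OF b] w]
        by (simp add: tw)
      then show ?thesis using nf[OF G a b] a b u(2) by simp
    qed
    \<comment> \<open>At \<open>(x, 1)\<close> and \<open>(1, y)\<close> the commutator vanishes, so the unit laws give the values of both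
      powers in \<open>G\<close>, whatever the exponents are as integers.\<close>
    have "x [^]\<^bsub>G\<^esub> i = x"
      using form[OF x one_closed] imaginary_addition_one_right[OF t is_group x] x
      by (simp add: commutator_def)
    moreover have "y [^]\<^bsub>G\<^esub> j = y"
      using form[OF one_closed y] imaginary_addition_one_left[OF t is_group y] y
      by (simp add: commutator_def)
    ultimately show "imaginary_addition t G (x, y) =
        x \<otimes>\<^bsub>G\<^esub> (y \<otimes>\<^bsub>G\<^esub> commutator G x y [^]\<^bsub>G\<^esub> n)"
      using form[OF x y] by simp
  qed
qed

section \<open>The second projection as an intrinsic Schreier split epimorphism\<close>

lemma split_epi_second_projection:
  assumes Y: "group Y" and P: "group P" and h: "h \<in> iso P (Y \<times>\<times> Y)"
  shows "split_epi_with_kernel P Y Y (snd \<circ> h)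
    (\<lambda>y. inv_into (carrier P) h (y, y)) (\<lambda>y. inv_into (carrier P) h (y, \<one>\<^bsub>Y\<^esub>))"
proof -
  interpret Y: group Y by (rule Y)
  let ?g = "inv_into (carrier P) h"
  have bij: "bij_betw h (carrier P) (carrier Y \<times> carrier Y)" and hom: "h \<in> hom P (Y \<times>\<times> Y)"
    using h by (auto simp: iso_def)
  have hg: "h (?g (a, b)) = (a, b)" if "a \<in> carrier Y" "b \<in> carrier Y" for a b
    using bij_betw_inv_into_right[OF bij] that by simp
  have gh: "?g (h p) = p" if "p \<in> carrier P" for p
    using bij_betw_inv_into_left[OF bij that] .
  have g: "?g \<in> hom (Y \<times>\<times> Y) P"
    using group.iso_set_sym[OF P h] by (simp add: iso_def)
  have s: "(\<lambda>y. (y, y)) \<in> hom Y (Y \<times>\<times> Y)" and k: "(\<lambda>y. (y, \<one>\<^bsub>Y\<^esub>)) \<in> hom Y (Y \<times>\<times> Y)"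
    by (auto intro!: homI)
  have pr: "snd \<in> hom (Y \<times>\<times> Y) Y" by (auto intro!: homI)
  have "(\<lambda>y. ?g (y, \<one>\<^bsub>Y\<^esub>)) \<in> mon Y P"
    by (rule mon_left_invertible[of _ _ _ "fst \<circ> h"])
      (use hom_compose[OF k g] in \<open>auto simp: comp_def hg\<close>)
  moreover have "(\<lambda>y. ?g (y, \<one>\<^bsub>Y\<^esub>)) ` carrier Y = kernel P Y (snd \<circ> h)"
  proof (intro equalityI subsetI)
    fix p assume "p \<in> kernel P Y (snd \<circ> h)"
    then have p: "p \<in> carrier P" "snd (h p) = \<one>\<^bsub>Y\<^esub>" by (auto simp: kernel_def)
    have "h p \<in> carrier Y \<times> carrier Y" using bij p(1) by (auto simp: bij_betw_def)
    then have "fst (h p) \<in> carrier Y" by auto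
    moreover have "h p = (fst (h p), \<one>\<^bsub>Y\<^esub>)" using p(2) by (simp add: prod_eq_iff)
    then have "p = ?g (fst (h p), \<one>\<^bsub>Y\<^esub>)" using gh[OF p(1)] by simp
    ultimately show "p \<in> (\<lambda>y. ?g (y, \<one>\<^bsub>Y\<^esub>)) ` carrier Y" by blast
  qed (use hom_in_carrier[OF g] in \<open>auto simp: kernel_def hg\<close>)
  ultimately show ?thesis
    unfolding split_epi_with_kernel_def
    using Y P hom_compose[OF hom pr] hom_compose[OF s g] by (auto simp: comp_def hg)
qed

theorem proposition11p12:
  fixes Y :: "('u::infinite) monoid" and t :: "'u imaginary_family"
  assumes "two_engel_group Y"
    and "natural_imaginary_splitting t"
  shows "intrinsic_schreier_special t Y"
proof -
  note t = assms(2)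
  have engel: "two_engel Y" using assms(1) by (simp add: two_engel_iff)
  interpret Y: two_engel Y by (rule engel)
  obtain n :: int where add: "\<And>x y. \<lbrakk>x \<in> carrier Y; y \<in> carrier Y\<rbrakk> \<Longrightarrow>
      imaginary_addition t Y (x, y) = x \<otimes>\<^bsub>Y\<^esub> (y \<otimes>\<^bsub>Y\<^esub> commutator Y x y [^]\<^bsub>Y\<^esub> n)"
    using two_engel_imaginary_addition[OF t] engel by blast
  define \<psi> where "\<psi> x y = x \<otimes>\<^bsub>Y\<^esub> (inv\<^bsub>Y\<^esub> y \<otimes>\<^bsub>Y\<^esub> commutator Y x y [^]\<^bsub>Y\<^esub> (- n))" for x y
  have \<psi>_closed: "\<psi> x y \<in> carrier Y" if "x \<in> carrier Y" "y \<in> carrier Y" for x y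
    using that by (simp add: \<psi>_def)
  have add_\<psi>: "imaginary_addition t Y (\<psi> x y, y) = x" if "x \<in> carrier Y" "y \<in> carrier Y" for x y
    using Y.twisted_translation_inverse(1)[OF that, of n] \<psi>_closed[OF that] that
    by (simp add: add \<psi>_def)
  have \<psi>_add: "\<psi> (imaginary_addition t Y (a, y)) y = a" if "a \<in> carrier Y" "y \<in> carrier Y" for a y
    using Y.twisted_translation_inverse(2)[OF that, of n] that by (simp add: add \<psi>_def)
  have "intrinsic_schreier t P Y Y (snd \<circ> h)
      (\<lambda>y. inv_into (carrier P) h (y, y)) (\<lambda>y. inv_into (carrier P) h (y, \<one>\<^bsub>Y\<^esub>))"
    if P: "group P" and h: "h \<in> iso P (Y \<times>\<times> Y)" for P :: "'u monoid" and h
  proof -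
    let ?g = "inv_into (carrier P) h"
    have bij: "bij_betw h (carrier P) (carrier Y \<times> carrier Y)" and hom: "h \<in> hom P (Y \<times>\<times> Y)"
      using h by (auto simp: iso_def)
    have hg: "h (?g (a, b)) = (a, b)" and g_closed: "?g (a, b) \<in> carrier P"
      if "a \<in> carrier Y" "b \<in> carrier Y" for a b
      using bij_betw_inv_into_right[OF bij] bij_betw_apply[OF bij_betw_inv_into[OF bij]] that by auto
    have pr: "fst \<circ> h \<in> hom P Y" "snd \<circ> h \<in> hom P Y"
      by (intro hom_compose[OF hom]; auto intro!: homI)+
    have h_add: "h (imaginary_addition t P (p, p')) =
        (imaginary_addition t Y (fst (h p), fst (h p')), imaginary_addition t Y (snd (h p), snd (h p')))"
      if "p \<in> carrier P" "p' \<in> carrier P" for p p'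
      using hom_imaginary_addition[OF t P Y.is_group pr(1) that]
        hom_imaginary_addition[OF t P Y.is_group pr(2) that] by (simp add: prod_eq_iff)
    define q where "q p = \<psi> (fst (h p)) (snd (h p))" for p
    have q: "q \<in> carrier P \<rightarrow> carrier Y"
      using bij_betw_apply[OF bij] by (auto simp: q_def mem_Times_iff intro!: \<psi>_closed)
    have "imaginary_addition t P (?g (q p, \<one>\<^bsub>Y\<^esub>), ?g ((snd \<circ> h) p, (snd \<circ> h) p)) = p"
      if p: "p \<in> carrier P" for p
    proof (rule inj_onD[OF bij_betw_imp_inj_on[OF bij]])
      obtain x y where xy: "h p = (x, y)" "x \<in> carrier Y" "y \<in> carrier Y"
        using bij_betw_apply[OF bij p] by auto
      then show "h (imaginary_addition t P (?g (q p, \<one>\<^bsub>Y\<^esub>), ?g ((snd \<circ> h) p, (snd \<circ> h) p))) = h p"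
        by (simp add: h_add g_closed hg q_def \<psi>_closed add_\<psi>
            imaginary_addition_one_left[OF t Y.is_group])
      show "imaginary_addition t P (?g (q p, \<one>\<^bsub>Y\<^esub>), ?g ((snd \<circ> h) p, (snd \<circ> h) p)) \<in> carrier P"
        using xy by (intro imaginary_addition_closed[OF t P] g_closed)
          (simp_all add: q_def \<psi>_closed)
    qed (rule p)
    moreover have "q (imaginary_addition t P (?g (a, \<one>\<^bsub>Y\<^esub>), ?g (y, y))) = a"
      if "a \<in> carrier Y" "y \<in> carrier Y" for a y
      using that by (simp add: q_def h_add g_closed hg \<psi>_add
          imaginary_addition_one_left[OF t Y.is_group])
    ultimately show ?thesis
      unfolding intrinsic_schreier_def
      using split_epi_second_projection[OF Y.is_group P h] q by blast
  qed
  then show ?thesis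
    unfolding intrinsic_schreier_special_def using Y.is_group by blast
qed

end
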